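(* Let $\varphi_e(z)=e^z$ and $\varphi_L(z)=\sqrt{1+z}$ (principal branch) for $z\in\mathbb D$. Then $$R_{\mathcal S^*(\varphi_L)}(\mathcal S^*(\varphi_e))=\tfrac12\log2.$$
   Context: Let $\mathbb D=\{z\in\mathbb C:|z|<1\}$ and let $\mathcal A$ be the class of functions $f$ analytic on $\mathbb D$ with $f(0)=0$ and $f'(0)=1$. For an analytic function $\varphi$ on $\mathbb D$ with $\varphi(0)=1$, the class $\mathcal S^*(\varphi)$ consists of all $f\in\mathcal A$ with $zf'(z)/f(z)\prec\varphi(z)$; that is, there is an analytic $\omega:\mathbb D\to\mathbb D$ with $\omega(0)=0$ such that $zf'(z)/f(z)=\varphi(\omega(z))$ on $\mathbb D$ (the quotient takes the value $1$ at $z=0$, and $f$ has no other zeros). For two such functions $\varphi_1,\varphi_2$, the sharp $\mathcal S^*(\varphi_2)$-radius of $\mathcal S^*(\varphi_1)$ is $$R_{\mathcal S^*(\varphi_2)}(\mathcal S^*(\varphi_1))=\sup\left\{r\in(0,1]: f_r(z)=\tfrac{f(rz)}{r}\text{ belongs to }\mathcal S^*(\varphi_2)\text{ for every } f\in\mathcal S^*(\varphi_1)\right\}.$$ *)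

theory Defs
  imports "HOL-Complex_Analysis.Complex_Analysis"
begin

abbreviation unit_disc :: "complex set" where
  "unit_disc \<equiv> ball 0 1"

text \<open>Functions on the unit disc are represented by total functions; only their values on
  the disc matter in the definitions below.\<close>

definition class_A :: "(complex \<Rightarrow> complex) set" where
  "class_A = {f. f holomorphic_on unit_disc \<and> f 0 = 0 \<and> deriv f 0 = 1}"

definition subordinate :: "(complex \<Rightarrow> complex) \<Rightarrow> (complex \<Rightarrow> complex) \<Rightarrow> bool" where
  "subordinate g h \<longleftrightarrow>
     (\<exists>\<omega>. \<omega> holomorphic_on unit_disc \<and> \<omega> ` unit_disc \<subseteq> unit_disc \<and> \<omega> 0 = 0 \<and>
        (\<forall>z\<in>unit_disc. g z = h (\<omega> z)))"

text \<open>The removable singularity of the quotient at the origin is filled in by its limit 1.\<close>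

definition starlike_quotient :: "(complex \<Rightarrow> complex) \<Rightarrow> complex \<Rightarrow> complex" where
  "starlike_quotient f z = (if z = 0 then 1 else z * deriv f z / f z)"

text \<open>The requirement that f has no zeros in the punctured disc is stated explicitly, since
  division by zero is total in HOL.\<close>

definition starlike_class :: "(complex \<Rightarrow> complex) \<Rightarrow> (complex \<Rightarrow> complex) set" where
  "starlike_class \<phi> =
     {f \<in> class_A. (\<forall>z\<in>unit_disc - {0}. f z \<noteq> 0) \<and> subordinate (starlike_quotient f) \<phi>}"

text \<open>\<open>starlike_radius \<phi>2 \<phi>1\<close> is the sharp radius of the class of \<open>\<phi>1\<close> with respect to the
  class of \<open>\<phi>2\<close>.\<close>

definition starlike_radius ::
    "(complex \<Rightarrow> complex) \<Rightarrow> (complex \<Rightarrow> complex) \<Rightarrow> real" where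
  "starlike_radius \<phi>2 \<phi>1 =
     Sup {r. 0 < r \<and> r \<le> 1 \<and>
             (\<forall>f\<in>starlike_class \<phi>1.
                (\<lambda>z. f (of_real r * z) / of_real r) \<in> starlike_class \<phi>2)}"

definition phi_e :: "complex \<Rightarrow> complex" where
  "phi_e z = exp z"

definition phi_L :: "complex \<Rightarrow> complex" where
  "phi_L z = csqrt (1 + z)"

end

theory Submission
  imports Defs
begin

text \<open>A Schwarz function \<open>\<omega>\<close> satisfies \<open>\<bar>\<omega> (r z)\<bar> \<le> r \<bar>z\<bar>\<close>, so the equation
  \<open>exp (\<omega> (r z)) = csqrt (1 + W z)\<close> is solved by \<open>W z = exp (2 \<omega> (r z)) - 1\<close>, which has modulus
  at most \<open>exp (2 r \<bar>z\<bar>) - 1 < 1\<close> as long as \<open>2 r \<le> ln 2\<close>. The bound is sharp for the function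
  with \<open>z f'(z) / f(z) = exp z\<close>: there \<open>W\<close> is forced to be \<open>exp (2 r z) - 1\<close>, which
  exceeds 1 at real \<open>z\<close> close to 1 when \<open>2 r > ln 2\<close>.\<close>

text \<open>Dropping the constant term leaves a power series with positive coefficients, so the
  triangle inequality can be applied termwise. Nonnegative reals give equality, which is why the
  extremal points below are real.\<close>

lemma norm_exp_minus_one_le:
  fixes z :: "'a::{real_normed_field,banach}"
  shows "norm (exp z - 1) \<le> exp (norm z) - 1"
proof -
  have "summable (\<lambda>n. norm z ^ Suc n /\<^sub>R fact (Suc n))"
    using summable_exp_generic[of "norm z"] by (subst summable_Suc_iff)
  moreover have "norm (z ^ Suc n /\<^sub>R fact (Suc n)) \<le> norm z ^ Suc n /\<^sub>R fact (Suc n)" for n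
    by (simp add: norm_power norm_mult del: fact_Suc)
  ultimately have "norm (\<Sum>n. z ^ Suc n /\<^sub>R fact (Suc n)) \<le> (\<Sum>n. norm z ^ Suc n /\<^sub>R fact (Suc n))"
    by (intro norm_suminf_le)
  then show ?thesis
    using exp_first_term[of z] exp_first_term[of "norm z"] by simp
qed

text \<open>The bound on \<open>Im w\<close> places \<open>exp w\<close> in the open right
  half-plane, where the principal root undoes squaring.\<close>

lemma csqrt_exp_double:
  assumes "\<bar>Im w\<bar> < pi / 2"
  shows "csqrt (exp (2 * w)) = exp w"
proof (rule csqrt_unique)
  show "(exp w)\<^sup>2 = exp (2 * w)"
    by (simp add: exp_double)
  show "0 < Re (exp w) \<or> Re (exp w) = 0 \<and> 0 \<le> Im (exp w)"
    using assms by (simp add: Re_exp cos_gt_zero_pi)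
qed

lemma norm_of_real_mult_less_1:
  fixes z :: complex
  assumes "0 < r" "r \<le> 1" "norm z < 1"
  shows "norm (of_real r * z) < 1"
  using mult_le_less_imp_less[of r 1 "norm z" 1] assms by (simp add: norm_mult)

lemma has_field_derivative_dilation:
  assumes "f holomorphic_on unit_disc" "0 < r" "r \<le> 1" "norm z < 1"
  shows "((\<lambda>z. f (of_real r * z) / of_real r) has_field_derivative deriv f (of_real r * z)) (at z)"
proof -
  have "(f has_field_derivative deriv f (of_real r * z)) (at (of_real r * z))"
    using assms by (intro holomorphic_derivI[of _ unit_disc]) (auto simp: norm_of_real_mult_less_1)
  moreover have "((\<lambda>z. of_real r * z) has_field_derivative of_real r) (at z)"
    by (auto intro!: derivative_eq_intros)
  ultimately have "((\<lambda>z. f (of_real r * z)) has_field_derivative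
      deriv f (of_real r * z) * of_real r) (at z)"
    by (rule DERIV_chain2)
  from DERIV_cdivide[OF this, of "of_real r"] show ?thesis
    using assms by simp
qed

lemma dilation_in_class_A:
  assumes "f \<in> class_A" "0 < r" "r \<le> 1"
  shows "(\<lambda>z. f (of_real r * z) / of_real r) \<in> class_A"
proof -
  have f: "f holomorphic_on unit_disc" "f 0 = 0" "deriv f 0 = 1"
    using assms by (auto simp: class_A_def)
  have "(\<lambda>z. f (of_real r * z) / of_real r) holomorphic_on unit_disc"
    using has_field_derivative_dilation[OF f(1) assms(2,3)]
    by (subst holomorphic_on_open) (simp, force)
  with f DERIV_imp_deriv[OF has_field_derivative_dilation[OF f(1) assms(2,3), of 0]]
  show ?thesis
    by (simp add: class_A_def)
qed

text \<open>The factor \<open>r\<close> that turns \<open>z\<close> into \<open>r * z\<close> is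
  supplied by the division by \<open>r\<close> in the denominator; at the origin both sides are 1 by
  convention.\<close>

lemma starlike_quotient_dilation:
  assumes "f \<in> class_A" "0 < r" "r \<le> 1" "norm z < 1"
  shows "starlike_quotient (\<lambda>z. f (of_real r * z) / of_real r) z =
    starlike_quotient f (of_real r * z)"
proof -
  have "f holomorphic_on unit_disc"
    using assms by (simp add: class_A_def)
  from DERIV_imp_deriv[OF has_field_derivative_dilation[OF this assms(2-4)]] assms
  show ?thesis
    by (simp add: starlike_quotient_def mult_ac)
qed

lemma dilation_in_starlike_class_phi_L:
  assumes f: "f \<in> starlike_class phi_e" and r: "0 < r" "r \<le> ln 2 / 2"
  shows "(\<lambda>z. f (of_real r * z) / of_real r) \<in> starlike_class phi_L"
proof -
  have r1: "r \<le> 1"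
    using r ln_2_less_1 by simp
  have fA: "f \<in> class_A" and nz: "\<And>z. norm z < 1 \<Longrightarrow> z \<noteq> 0 \<Longrightarrow> f z \<noteq> 0"
    using f by (auto simp: starlike_class_def)
  obtain \<omega> where \<omega>: "\<omega> holomorphic_on unit_disc" "\<omega> ` unit_disc \<subseteq> unit_disc" "\<omega> 0 = 0"
    and q: "\<And>z. norm z < 1 \<Longrightarrow> starlike_quotient f z = exp (\<omega> z)"
    using f by (auto simp: starlike_class_def subordinate_def phi_e_def)
  note lt1 = norm_of_real_mult_less_1[OF r(1) r1]
  have bound: "norm (\<omega> (of_real r * z)) \<le> r * norm z" if "norm z < 1" for z
  proof -
    have "norm (\<omega> (of_real r * z)) \<le> norm (of_real r * z)"
      using \<omega> lt1[OF that] by (intro Schwarz_Lemma(1)) (auto simp: image_subset_iff)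
    then show ?thesis
      using r by (simp add: norm_mult)
  qed
  define W where "W z = exp (2 * \<omega> (of_real r * z)) - 1" for z
  have "\<omega> \<circ> (\<lambda>z. of_real r * z) holomorphic_on unit_disc"
    by (rule holomorphic_on_compose_gen[OF _ \<omega>(1)]) (auto intro!: holomorphic_intros lt1)
  then have "W holomorphic_on unit_disc"
    unfolding W_def o_def by (intro holomorphic_intros)
  moreover have "W ` unit_disc \<subseteq> unit_disc"
  proof clarsimp
    fix z :: complex assume z: "norm z < 1"
    have "norm (W z) \<le> exp (norm (2 * \<omega> (of_real r * z))) - 1"
      unfolding W_def by (rule norm_exp_minus_one_le)
    also have "norm (2 * \<omega> (of_real r * z)) < ln 2"
    proof -
      have "norm (\<omega> (of_real r * z)) \<le> r * norm z"
        by (rule bound[OF z])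
      \<comment> \<open>Strictness comes from \<open>norm z < 1\<close> and \<open>0 < r\<close>. It
        keeps \<open>W\<close> inside the open disc even at the endpoint
        \<open>r = ln 2 / 2\<close>.\<close>
      also have "\<dots> < r"
        using z r by simp
      finally show ?thesis
        using r by (simp add: norm_mult)
    qed
    then have "exp (norm (2 * \<omega> (of_real r * z))) < exp (ln 2)"
      by (simp only: exp_less_cancel_iff)
    finally show "norm (W z) < 1"
      by simp
  qed
  moreover have "W 0 = 0"
    using \<omega> by (simp add: W_def)
  moreover have "starlike_quotient (\<lambda>z. f (of_real r * z) / of_real r) z = phi_L (W z)"
    if z: "norm z < 1" for z
  proof -
    \<comment> \<open>Values of a Schwarz function have modulus below 1, hence imaginary part below
      \<open>pi / 2\<close>, so the principal branch is the right one.\<close>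
    have "\<bar>Im (\<omega> (of_real r * z))\<bar> \<le> norm (\<omega> (of_real r * z))"
      by (rule abs_Im_le_cmod)
    also have "\<dots> < 1"
      using \<omega>(2) lt1[OF z] by (auto simp: image_subset_iff)
    also have "\<dots> < pi / 2"
      using pi_gt3 by simp
    finally have "csqrt (exp (2 * \<omega> (of_real r * z))) = exp (\<omega> (of_real r * z))"
      by (rule csqrt_exp_double)
    then show ?thesis
      using z by (simp add: starlike_quotient_dilation[OF fA r(1) r1] q lt1 phi_L_def W_def)
  qed
  ultimately have "subordinate (starlike_quotient (\<lambda>z. f (of_real r * z) / of_real r)) phi_L"
    unfolding subordinate_def by (intro exI[of _ W]) auto
  then show ?thesis
    using dilation_in_class_A[OF fA r(1) r1] nz lt1 r by (simp add: starlike_class_def)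
qed

text \<open>The equation z f'/f = exp z says that log (f/z) has derivative (exp z - 1)/z. This has a
  removable singularity at 0, hence a primitive on the disc, which is then exponentiated.\<close>

lemma ex_starlike_quotient_eq_exp:
  obtains f where "f \<in> starlike_class phi_e" "\<And>z. norm z < 1 \<Longrightarrow> starlike_quotient f z = exp z"
proof -
  define h :: "complex \<Rightarrow> complex" where "h z = (if z = 0 then 1 else (exp z - 1) / z)" for z
  have "(exp has_field_derivative 1) (at (0::complex))"
    using DERIV_exp[of "0::complex"] by simp
  then have "(\<lambda>z::complex. (exp z - 1) / z) \<midarrow>0\<rightarrow> 1"
    by (simp add: has_field_derivative_iff)
  then have "h holomorphic_on unit_disc"
    unfolding h_def by (intro removable_singularity holomorphic_intros) auto
  then obtain g where g: "\<And>z. z \<in> unit_disc \<Longrightarrow> (g has_field_derivative h z) (at z within unit_disc)"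
    using holomorphic_convex_primitive'[of unit_disc h] by auto
  then have g': "(g has_field_derivative h z) (at z)" if "norm z < 1" for z
    using that by (metis at_within_open mem_ball_0 open_ball)
  \<comment> \<open>Subtracting \<open>g 0\<close> normalises the derivative of \<open>f\<close> at
    0 to 1; the exponential factor rules out zeros other than 0.\<close>
  define f where "f z = z * exp (g z - g 0)" for z
  have zh: "1 + z * h z = exp z" for z
    by (simp add: h_def)
  have f': "(f has_field_derivative exp z * exp (g z - g 0)) (at z)" if "norm z < 1" for z
    unfolding f_def zh[symmetric, of z]
    by (auto intro!: derivative_eq_intros g' that simp: algebra_simps)
  have "f holomorphic_on unit_disc"
    using f' by (subst holomorphic_on_open) (simp, force)
  moreover have "f 0 = 0"
    by (simp add: f_def)
  moreover have deriv: "deriv f z = exp z * exp (g z - g 0)" if "norm z < 1" for z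
    using f'[OF that] by (rule DERIV_imp_deriv)
  ultimately have "f \<in> class_A"
    by (simp add: class_A_def)
  moreover have q: "starlike_quotient f z = exp z" if "norm z < 1" for z
    using that by (simp add: starlike_quotient_def deriv f_def)
  \<comment> \<open>The identity is the Schwarz function here.\<close>
  then have "subordinate (starlike_quotient f) phi_e"
    unfolding subordinate_def phi_e_def by (intro exI[of _ "\<lambda>z. z"]) auto
  ultimately have "f \<in> starlike_class phi_e"
    by (simp add: starlike_class_def f_def)
  then show ?thesis
    using q that by blast
qed

lemma dilation_radius_le:
  assumes f: "f \<in> class_A" and q: "\<And>z. norm z < 1 \<Longrightarrow> starlike_quotient f z = exp z"
    and r: "0 < r" "r \<le> 1"
    and "(\<lambda>z. f (of_real r * z) / of_real r) \<in> starlike_class phi_L"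
  shows "r \<le> ln 2 / 2"
proof (rule ccontr)
  assume "\<not> r \<le> ln 2 / 2"
  then have "ln 2 / 2 / r < 1"
    using r by simp
  \<comment> \<open>A real point of the disc with \<open>2 * r * x > ln 2\<close>, where the forced
    value of the Schwarz function exceeds 1.\<close>
  then obtain x where x: "ln 2 / 2 / r < x" "x < 1"
    using dense by blast
  have "0 < ln 2 / 2 / r"
    using r by simp
  with x have x0: "0 < x"
    by linarith
  obtain \<omega> where \<omega>: "\<omega> ` unit_disc \<subseteq> unit_disc"
    and eq: "\<And>z. norm z < 1 \<Longrightarrow>
      starlike_quotient (\<lambda>z. f (of_real r * z) / of_real r) z = csqrt (1 + \<omega> z)"
    using assms(5) by (auto simp: starlike_class_def subordinate_def phi_L_def)
  have nx: "norm (of_real x :: complex) < 1"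
    using x x0 by simp
  have "exp (of_real (r * x)) = csqrt (1 + \<omega> (of_real x))"
    using eq[OF nx] starlike_quotient_dilation[OF f r nx] q[OF norm_of_real_mult_less_1[OF r nx]]
    by simp
  \<comment> \<open>Squaring removes the root whatever its branch, so the value of
    \<open>\<omega>\<close> at \<open>x\<close> is determined.\<close>
  then have "1 + \<omega> (of_real x) = (exp (of_real (r * x)))\<^sup>2"
    by simp
  also have "\<dots> = of_real (exp (2 * (r * x)))"
    by (metis exp_double exp_of_real of_real_power)
  finally have "\<omega> (of_real x) = of_real (exp (2 * (r * x)) - 1)"
    by (simp add: algebra_simps)
  moreover have "norm (\<omega> (of_real x)) < 1"
    using \<omega> nx by (auto simp: image_subset_iff)
  ultimately have "\<bar>exp (2 * (r * x)) - 1\<bar> < 1"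
    by (simp only: norm_of_real)
  then have "exp (2 * (r * x)) < exp (ln 2)"
    by simp
  then have "2 * (r * x) < ln 2"
    by (simp only: exp_less_cancel_iff)
  with x r show False
    by (simp add: field_simps)
qed

theorem theorem7p15:
  shows "starlike_radius phi_L phi_e = (1 / 2) * ln 2"
proof -
  obtain f where f: "f \<in> starlike_class phi_e" "\<And>z. norm z < 1 \<Longrightarrow> starlike_quotient f z = exp z"
    using ex_starlike_quotient_eq_exp by blast
  show ?thesis
    unfolding starlike_radius_def
  \<comment> \<open>The supremum is attained, since the endpoint \<open>ln 2 / 2\<close> is itself
    admissible.\<close>
  proof (rule cSup_eq_maximum)
    show "1 / 2 * ln 2 \<in> {r. 0 < r \<and> r \<le> 1 \<and> (\<forall>f\<in>starlike_class phi_e.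
        (\<lambda>z. f (of_real r * z) / of_real r) \<in> starlike_class phi_L)}"
      using dilation_in_starlike_class_phi_L[of _ "1 / 2 * ln 2"] ln_2_less_1 by simp
  next
    fix r :: real
    assume "r \<in> {r. 0 < r \<and> r \<le> 1 \<and> (\<forall>f\<in>starlike_class phi_e.
        (\<lambda>z. f (of_real r * z) / of_real r) \<in> starlike_class phi_L)}"
    then show "r \<le> 1 / 2 * ln 2"
      using dilation_radius_le[OF _ f(2), of r] f(1) by (auto simp: starlike_class_def)
  qed
qed

end
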